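(* Let $\mathcal{A}$ be a regular Rickart *-ring and $b\in\mathcal{A}$. Then $[0,b]^{*|\ell\square}$, $[0,b]^{*|r\square}$ and $[0,b]^{*|\square}$ are lattices. Moreover, $[0,b]^{*|\square}$ is a sublattice of both $[0,b]^{*|\ell\square}$ and $[0,b]^{*|r\square}$.
   Context: A *-ring is an (associative) ring $\mathcal{A}$ with an involution $*$: $(a+b)^*=a^*+b^*$, $(ab)^*=b^*a^*$, $(a^* )^*=a$. It is a Rickart *-ring if for every $a\in\mathcal{A}$ there is a self-adjoint idempotent $p$ (i.e. $p=p^*=p^2$) with $\{x\in\mathcal{A}: xa=0\}=\mathcal{A}(1-p)$; such a ring has an identity $1$, and $p$ is unique and denoted $\mathrm{lp}(a)$. Likewise, for every $a$ there is a unique self-adjoint idempotent $\mathrm{rp}(a)$ with $\{x\in\mathcal{A}: ax=0\}=(1-\mathrm{rp}(a))\mathcal{A}$. The ring is regular if for every $a\in\mathcal{A}$ there is $a^-\in\mathcal{A}$ with $aa^-a=a$. Partial orders on $\mathcal{A}$: $a\preceq^{*|\ell\square} b$ iff $\mathrm{lp}(a)b=a=b\,\mathrm{rp}(a)$ and $a^2=ab$; $a\preceq^{*|r\square} b$ iff $\mathrm{lp}(a)b=a=b\,\mathrm{rp}(a)$ and $a^2=ba$; $a\preceq^{*|\square} b$ iff $\mathrm{lp}(a)b=a=b\,\mathrm{rp}(a)$ and $a^2=ab=ba$. For each such $\alpha$, $[0,b]^{\alpha}=\{a\in\mathcal{A}: a\preceq^{\alpha}b\}$, ordered by $\preceq^{\alpha}$.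 A sublattice of a lattice $L$ is a nonempty subset closed under the operations $\vee$ and $\wedge$ of $L$. *)

theory Defs
  imports "HOL-Algebra.Lattice"
begin

class star_ring = ring +
  fixes star :: "'a \<Rightarrow> 'a"
  assumes star_add: "star (a + b) = star a + star b"
    and star_mult: "star (a * b) = star b * star a"
    and star_star: "star (star a) = a"

definition projection :: "'a::star_ring \<Rightarrow> bool"
  where "projection p \<longleftrightarrow> star p = p \<and> p * p = p"

text \<open>The annihilator condition presupposes an identity. It is supplied by the class
  \<open>monoid_mult\<close> rather than \<open>ring_1\<close>, so that the zero ring is not excluded.\<close>

class rickart_star_ring = star_ring + monoid_mult +
  assumes rickart:
    "\<exists>p. (star p = p \<and> p * p = p) \<and> {x. x * a = 0} = {y * (1 - p) | y. True}"

class regular_rickart_star_ring = rickart_star_ring +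
  assumes regular: "\<exists>c. a * c * a = a"

definition lp :: "'a::rickart_star_ring \<Rightarrow> 'a"
  where "lp a = (THE p. projection p \<and> {x. x * a = 0} = {y * (1 - p) | y. True})"

definition rp :: "'a::rickart_star_ring \<Rightarrow> 'a"
  where "rp a = (THE q. projection q \<and> {x. a * x = 0} = {(1 - q) * y | y. True})"

lemma star_one: "star 1 = (1 :: 'a::rickart_star_ring)"
proof -
  have "star (star 1 * 1) = star 1 * (1 :: 'a)" by (simp only: star_mult star_star)
  then show ?thesis by (simp add: star_star)
qed

lemma star_zero: "star 0 = (0 :: 'a::star_ring)"
proof -
  have "star 0 + star (0 :: 'a) = star 0" by (simp flip: star_add)
  then show ?thesis by simp
qed

lemma star_diff: "star (a - b) = star a - star (b :: 'a::star_ring)"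
proof -
  have "star (a - b) + star b = star a" by (simp flip: star_add)
  then show ?thesis by (simp add: eq_diff_eq)
qed

text \<open>The descriptions in the definitions of \<open>lp\<close> and \<open>rp\<close> are proper.\<close>

lemma projection_unique_left:
  fixes p q :: "'a::rickart_star_ring"
  assumes p: "projection p" and q: "projection q"
    and eq: "{y * (1 - p) | y. True} = {y * (1 - q) | y. True}"
  shows "p = q"
proof -
  have absorb: "(1 - r) * (1 - s) = 1 - r"
    if s: "projection s" and sub: "{y * (1 - r) | y. True} = {y * (1 - s) | y. True}"
    for r s :: 'a
  proof -
    have "1 * (1 - r) \<in> {y * (1 - s) | y. True}" using sub by blast
    then obtain y where y: "1 - r = y * (1 - s)" by auto
    have "(1 - s) * (1 - s) = 1 - s"
      using s by (simp add: projection_def algebra_simps)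
    then show ?thesis by (simp add: y mult.assoc)
  qed
  have st: "star (1 - p) = 1 - p" "star (1 - q) = 1 - q"
    using p q by (simp_all add: projection_def star_diff star_one)
  have "1 - p = star ((1 - p) * (1 - q))"
    using absorb[OF q eq] st by simp
  also have "\<dots> = (1 - q) * (1 - p)" by (simp add: star_mult st)
  also have "\<dots> = 1 - q" by (rule absorb[OF p eq[symmetric]])
  finally show ?thesis by simp
qed

lemma right_annihilator_iff:
  fixes a q :: "'a::rickart_star_ring"
  assumes q: "projection q"
  shows "{x. a * x = 0} = {(1 - q) * y | y. True} \<longleftrightarrow>
    {x. x * star a = 0} = {y * (1 - q) | y. True}"
proof -
  have st: "star (1 - q) = 1 - q"
    using q by (simp add: projection_def star_diff star_one)
  have inj: "inj (star :: 'a \<Rightarrow> 'a)"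
    by (rule inj_on_inverseI[of _ star]) (rule star_star)
  have 1: "star ` {x. a * x = 0} = {x. x * star a = 0}"
  proof (intro Set.set_eqI iffI)
    fix x assume "x \<in> star ` {x. a * x = 0}"
    then obtain z where z: "x = star z" "a * z = 0" by blast
    have "x * star a = star (a * z)" by (simp only: z(1) star_mult)
    then show "x \<in> {x. x * star a = 0}" by (simp add: z(2) star_zero)
  next
    fix x assume x: "x \<in> {x. x * star a = 0}"
    have "a * star x = star (x * star a)" by (simp only: star_mult star_star)
    then have "star x \<in> {x. a * x = 0}" using x by (simp add: star_zero)
    then have "star (star x) \<in> star ` {x. a * x = 0}" by (rule imageI)
    then show "x \<in> star ` {x. a * x = 0}" by (simp only: star_star)
  qed
  have "star ((1 - q) * y) = star y * (1 - q)" for y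
    by (simp only: star_mult st)
  then have "star ` {(1 - q) * y | y. True} = {star y * (1 - q) | y. True}"
    by (simp add: full_SetCompr_eq image_image)
  also have "\<dots> = {y * (1 - q) | y. True}"
  proof -
    have "\<exists>z. y * (1 - q) = star z * (1 - q)" for y
      by (rule exI[of _ "star y"]) (simp add: star_star)
    then show ?thesis by blast
  qed
  finally have 2: "star ` {(1 - q) * y | y. True} = {y * (1 - q) | y. True}" .
  show ?thesis
    by (simp only: 1[symmetric] 2[symmetric] inj_image_eq_iff[OF inj])
qed

lemma lp_ex1:
  "\<exists>!p. projection p \<and> {x. x * a = 0} = {y * (1 - p) | y. True}"
  for a :: "'a::rickart_star_ring"
proof (rule ex_ex1I)
  show "\<exists>p. projection p \<and> {x. x * a = 0} = {y * (1 - p) | y. True}"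
    unfolding projection_def by (rule rickart)
qed (rule projection_unique_left, auto)

lemma rp_ex1:
  "\<exists>!q. projection q \<and> {x. a * x = 0} = {(1 - q) * y | y. True}"
  for a :: "'a::rickart_star_ring"
proof -
  have "(\<lambda>q. projection q \<and> {x. a * x = 0} = {(1 - q) * y | y. True}) =
    (\<lambda>q. projection q \<and> {x. x * star a = 0} = {y * (1 - q) | y. True})"
    by (intro ext conj_cong refl right_annihilator_iff)
  then show ?thesis using lp_ex1[of "star a"] by simp
qed

definition le_star_lsq :: "'a::rickart_star_ring \<Rightarrow> 'a \<Rightarrow> bool"
  where "le_star_lsq a b \<longleftrightarrow> (lp a * b = a \<and> a = b * rp a) \<and> a ^ 2 = a * b"

definition le_star_rsq :: "'a::rickart_star_ring \<Rightarrow> 'a \<Rightarrow> bool"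
  where "le_star_rsq a b \<longleftrightarrow> (lp a * b = a \<and> a = b * rp a) \<and> a ^ 2 = b * a"

definition le_star_sq :: "'a::rickart_star_ring \<Rightarrow> 'a \<Rightarrow> bool"
  where "le_star_sq a b \<longleftrightarrow> (lp a * b = a \<and> a = b * rp a) \<and> a ^ 2 = a * b \<and> a * b = b * a"

definition initial_segment :: "('a \<Rightarrow> 'a \<Rightarrow> bool) \<Rightarrow> 'a \<Rightarrow> 'a gorder"
  where "initial_segment r b = \<lparr>carrier = {a. r a b}, eq = (=), le = r\<rparr>"

definition sublattice :: "'a set \<Rightarrow> 'a gorder \<Rightarrow> bool"
  where "sublattice H L \<longleftrightarrow> H \<noteq> {} \<and> H \<subseteq> carrier L \<and>
    (\<forall>x\<in>H. \<forall>y\<in>H. x \<squnion>\<^bsub>L\<^esub> y \<in> H \<and> x \<sqinter>\<^bsub>L\<^esub> y \<in> H)"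

end

theory Submission
  imports Defs
begin

text \<open>For fixed \<open>b\<close>, an element \<open>a\<close> below \<open>b\<close> in the star order is determined by the projection
  \<open>q = rp a\<close>, since \<open>a = b * q\<close>; the projections that occur are those \<open>q \<le> rp b\<close> which commute with
  \<open>star b * b\<close>. The additional conditions \<open>a\<^sup>2 = a * b\<close> and \<open>a\<^sup>2 = b * a\<close> say that the right ideal
  of \<open>1 - q\<close> is invariant under \<open>b\<close> and that the right ideal of \<open>q\<close> is invariant under \<open>rp b * b\<close>,
  respectively. By regularity, the right ideal of a join of projections is the sum of their right
  ideals and that of a meet is the intersection, so that both operations preserve invariance.
  Hence the three segments are isomorphic to sets of projections that are closed under the same
  meets and joins.\<close>

section \<open>Projections\<close>

lemma projection_mult_self: "projection p \<Longrightarrow> p * p = p"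
  by (simp add: projection_def)

lemma projection_star: "projection p \<Longrightarrow> star p = p"
  by (simp add: projection_def)

lemma projection_zero: "projection (0 :: 'a::star_ring)"
  by (simp add: projection_def star_zero)

lemma projection_compl:
  fixes p :: "'a::rickart_star_ring"
  shows "projection p \<Longrightarrow> projection (1 - p)"
  by (simp add: projection_def star_diff star_one algebra_simps)

text \<open>Adjoints interchange the two equations. Either one expresses \<open>q\<close> below
  \<open>p\<close> in the order of projections, and later proofs switch freely between the two
  forms.\<close>

lemma projection_absorb_iff:
  assumes "projection p" "projection q"
  shows "p * q = q \<longleftrightarrow> q * p = q"
  using assms star_mult[of p q] star_mult[of q p] by (auto simp: projection_def)

lemma mem_right_ideal_compl_iff:
  fixes q :: "'a::rickart_star_ring"
  assumes "projection q"
  shows "x \<in> {(1 - q) * y | y. True} \<longleftrightarrow> q * x = 0"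
proof
  assume "x \<in> {(1 - q) * y | y. True}"
  then obtain y where "x = (1 - q) * y" by blast
  then show "q * x = 0"
    by (simp add: right_diff_distrib projection_mult_self[OF assms] flip: mult.assoc)
next
  assume "q * x = 0"
  then have "x = (1 - q) * x" by (simp add: left_diff_distrib)
  then show "x \<in> {(1 - q) * y | y. True}" by blast
qed

lemma mem_left_ideal_compl_iff:
  fixes p :: "'a::rickart_star_ring"
  assumes "projection p"
  shows "x \<in> {y * (1 - p) | y. True} \<longleftrightarrow> x * p = 0"
proof
  assume "x \<in> {y * (1 - p) | y. True}"
  then obtain y where "x = y * (1 - p)" by blast
  then show "x * p = 0"
    by (simp add: left_diff_distrib projection_mult_self[OF assms] mult.assoc)
next
  assume "x * p = 0"
  then have "x = x * (1 - p)" by (simp add: right_diff_distrib)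
  then show "x \<in> {y * (1 - p) | y. True}" by blast
qed

text \<open>Membership in the left ideal of \<open>1 - lp a\<close> means annihilating
  \<open>lp a\<close>, so the set equation becomes an equivalence usable for rewriting.\<close>

lemma lp_spec: "projection (lp a)" "x * a = 0 \<longleftrightarrow> x * lp a = 0"
proof -
  have *: "projection (lp a) \<and> {x. x * a = 0} = {y * (1 - lp a) | y. True}"
    unfolding lp_def by (rule theI'[OF lp_ex1])
  then show p: "projection (lp a)" by blast
  have "x * a = 0 \<longleftrightarrow> x \<in> {y * (1 - lp a) | y. True}" using * by blast
  then show "x * a = 0 \<longleftrightarrow> x * lp a = 0" by (simp only: mem_left_ideal_compl_iff[OF p])
qed

lemma rp_spec: "projection (rp a)" "a * x = 0 \<longleftrightarrow> rp a * x = 0"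
proof -
  have *: "projection (rp a) \<and> {x. a * x = 0} = {(1 - rp a) * y | y. True}"
    unfolding rp_def by (rule theI'[OF rp_ex1])
  then show p: "projection (rp a)" by blast
  have "a * x = 0 \<longleftrightarrow> x \<in> {(1 - rp a) * y | y. True}" using * by blast
  then show "a * x = 0 \<longleftrightarrow> rp a * x = 0" by (simp only: mem_right_ideal_compl_iff[OF p])
qed

lemma rp_eqI:
  assumes q: "projection q" and *: "\<And>x. a * x = 0 \<longleftrightarrow> q * x = 0"
  shows "rp a = q"
  unfolding rp_def
proof (intro the1_equality[OF rp_ex1] conjI q Set.set_eqI)
  fix x
  show "x \<in> {x. a * x = 0} \<longleftrightarrow> x \<in> {(1 - q) * y | y. True}"
    unfolding mem_right_ideal_compl_iff[OF q] by (simp add: *)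
qed

lemma lp_mult_self: "lp a * a = a"
proof -
  have "(1 - lp a) * a = 0"
    by (subst lp_spec(2)) (simp add: left_diff_distrib projection_mult_self[OF lp_spec(1)])
  then show ?thesis by (simp add: left_diff_distrib)
qed

lemma mult_rp_self: "a * rp a = a"
proof -
  have "a * (1 - rp a) = 0"
    by (subst rp_spec(2)) (simp add: right_diff_distrib projection_mult_self[OF rp_spec(1)])
  then show ?thesis by (simp add: right_diff_distrib)
qed

lemma mult_left_eq_iff: "b * x = b * y \<longleftrightarrow> rp b * x = rp b * y"
  using rp_spec(2)[of b "x - y"] by (simp add: right_diff_distrib)

text \<open>If \<open>a * c * a = a\<close>, then \<open>1 - a * c\<close> annihilates
  \<open>a\<close> from the left, hence also \<open>lp a\<close>. Thus regularity puts
  \<open>lp a\<close> into the right ideal of \<open>a\<close> itself.\<close>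

lemma lp_factor:
  fixes a :: "'a::regular_rickart_star_ring"
  obtains y where "lp a = a * y"
proof -
  obtain c where "a * c * a = a" using regular by blast
  then have "(1 - a * c) * a = 0" by (simp add: left_diff_distrib)
  then have "(1 - a * c) * lp a = 0" by (subst (asm) lp_spec(2))
  then have "lp a = a * (c * lp a)" by (simp add: left_diff_distrib mult.assoc)
  then show thesis by (rule that)
qed

section \<open>Joins and meets of projections\<close>

text \<open>The summand is the left projection of the part of \<open>q\<close> orthogonal to
  \<open>p\<close>. Being orthogonal to \<open>p\<close>, it can be added to give a
  projection.\<close>

definition proj_join :: "'a::rickart_star_ring \<Rightarrow> 'a \<Rightarrow> 'a"
  where "proj_join p q = p + lp ((1 - p) * q)"

text \<open>De Morgan dual of the join, so that facts about complements carry over by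
  unfolding.\<close>

definition proj_meet :: "'a::rickart_star_ring \<Rightarrow> 'a \<Rightarrow> 'a"
  where "proj_meet p q = 1 - proj_join (1 - p) (1 - q)"

lemma projection_join:
  assumes p: "projection p"
  shows "projection (proj_join p q)"
    and "proj_join p q * p = p"
proof -
  let ?s = "lp ((1 - p) * q)"
  \<comment> \<open>What annihilates an element from the left annihilates its left projection. This
    gives orthogonality on one side, and adjoints give it on the other.\<close>
  have "p * ((1 - p) * q) = 0"
    by (simp add: right_diff_distrib projection_mult_self[OF p] flip: mult.assoc)
  then have ps: "p * ?s = 0" by (subst (asm) lp_spec(2))
  have s: "star ?s = ?s" "?s * ?s = ?s"
    using lp_spec(1) by (auto simp: projection_def)
  have "?s * p = star (p * ?s)" by (simp add: star_mult s projection_star[OF p])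
  then have sp: "?s * p = 0" by (simp add: ps star_zero)
  show "projection (proj_join p q)" "proj_join p q * p = p"
    using p by (simp_all add: proj_join_def projection_def star_add s ps sp distrib_left distrib_right)
qed

lemma proj_join_absorb_right:
  assumes p: "projection p"
  shows "proj_join p q * q = q"
proof -
  let ?s = "lp ((1 - p) * q)"
  have "?s * ((1 - p) * q) = (1 - p) * q" by (rule lp_mult_self)
  moreover have "?s * p = 0"
  proof -
    have "(p + ?s) * p = p" using projection_join(2)[OF p, of q] by (simp add: proj_join_def)
    then show ?thesis by (simp add: distrib_right projection_mult_self[OF p])
  qed
  ultimately have "?s * q = q - p * q"
    by (simp add: left_diff_distrib right_diff_distrib flip: mult.assoc)
  then show ?thesis by (simp add: proj_join_def distrib_right)
qed

text \<open>Writing the left projection as \<open>(1 - p) * q * y\<close> and expanding puts the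
  join into the sum of the right ideals of \<open>p\<close> and \<open>q\<close>. Leastness and
  invariance of joins rest on this form.\<close>

lemma proj_join_decomp:
  fixes p q :: "'a::regular_rickart_star_ring"
  obtains y z where "proj_join p q = p * y + q * z"
proof -
  obtain y where "lp ((1 - p) * q) = (1 - p) * q * y" by (rule lp_factor)
  then have "proj_join p q = p * (1 - q * y) + q * y"
    by (simp add: proj_join_def algebra_simps)
  then show thesis by (rule that)
qed

lemma proj_join_least:
  fixes p q :: "'a::regular_rickart_star_ring"
  assumes "r * p = p" "r * q = q"
  shows "r * proj_join p q = proj_join p q"
proof -
  obtain y z where "proj_join p q = p * y + q * z" by (rule proj_join_decomp)
  then show ?thesis using assms by (simp add: distrib_left flip: mult.assoc)
qed

lemma projection_meet:
  assumes "projection p"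
  shows "projection (proj_meet p q)"
  unfolding proj_meet_def by (intro projection_compl projection_join(1) assms)

lemma proj_meet_absorb:
  assumes p: "projection p" and q: "projection q"
  shows "p * proj_meet p q = proj_meet p q" "q * proj_meet p q = proj_meet p q"
proof -
  let ?r = "proj_join (1 - p) (1 - q)"
  note p' = projection_compl[OF p] and q' = projection_compl[OF q]
  have "(1 - p) * ?r = 1 - p"
    using projection_join[OF p', of "1 - q"] projection_absorb_iff[OF _ p', of ?r] by blast
  then show "p * proj_meet p q = proj_meet p q"
    by (simp add: proj_meet_def algebra_simps)
  have "(1 - q) * ?r = 1 - q"
    using projection_join(1)[OF p', of "1 - q"] proj_join_absorb_right[OF p', of "1 - q"]
      projection_absorb_iff[OF _ q', of ?r] by blast
  then show "q * proj_meet p q = proj_meet p q"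
    by (simp add: proj_meet_def algebra_simps)
qed

text \<open>Here \<open>w\<close> is any ring element, not just a projection: the intersection of
  the two right ideals lies in that of the meet. Invariance of meets needs this generality.\<close>

lemma proj_meet_greatest:
  fixes p q :: "'a::regular_rickart_star_ring"
  assumes p: "projection p" and q: "projection q" and w: "p * w = w" "q * w = w"
  shows "proj_meet p q * w = w"
proof -
  let ?r = "proj_join (1 - p) (1 - q)"
  obtain y z where yz: "?r = (1 - p) * y + (1 - q) * z" by (rule proj_join_decomp)
  \<comment> \<open>Taking adjoints moves \<open>1 - p\<close> and \<open>1 - q\<close> to the right
    ends of the summands, where they annihilate \<open>w\<close>.\<close>
  have "?r = star ?r"
    using projection_join(1)[OF projection_compl[OF p]] by (simp add: projection_def)
  also have "\<dots> = star y * (1 - p) + star z * (1 - q)"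
    using projection_compl[OF p] projection_compl[OF q]
    by (simp add: yz star_add star_mult projection_def)
  finally have "?r * w = 0"
    by (simp add: distrib_right mult.assoc left_diff_distrib w)
  then show ?thesis by (simp add: proj_meet_def left_diff_distrib)
qed

section \<open>Right ideals of projections invariant under left multiplication\<close>

definition right_invariant :: "'a::ring \<Rightarrow> 'a \<Rightarrow> bool"
  where "right_invariant x q \<longleftrightarrow> q * (x * q) = x * q"

text \<open>Left multiplication by \<open>x\<close> maps the right ideals of \<open>p\<close> and
  \<open>q\<close> into themselves, hence also their sum, which contains the join.\<close>

lemma right_invariant_join:
  fixes p q :: "'a::regular_rickart_star_ring"
  assumes p: "projection p" and inv: "right_invariant x p" "right_invariant x q"
  shows "right_invariant x (proj_join p q)"
proof -
  let ?r = "proj_join p q"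
  obtain y z where yz: "?r = p * y + q * z" by (rule proj_join_decomp)
  have "?r * (x * p) = ?r * p * (x * p)"
    using inv(1) by (simp add: right_invariant_def mult.assoc)
  then have 1: "?r * (x * p) = x * p"
    using inv(1) by (simp add: projection_join(2)[OF p] right_invariant_def)
  have "?r * (x * q) = ?r * q * (x * q)"
    using inv(2) by (simp add: right_invariant_def mult.assoc)
  then have 2: "?r * (x * q) = x * q"
    using inv(2) by (simp add: proj_join_absorb_right[OF p] right_invariant_def)
  have "?r * (x * ?r) = ?r * (x * p) * y + ?r * (x * q) * z"
    by (subst (2) yz) (simp add: distrib_left mult.assoc)
  also have "\<dots> = x * ?r" by (simp only: 1 2) (simp add: yz distrib_left mult.assoc)
  finally show ?thesis by (simp add: right_invariant_def)
qed

text \<open>The meet lies in both right ideals, so by invariance its product with \<open>x\<close>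
  does too, and therefore lies in the right ideal of the meet.\<close>

lemma right_invariant_meet:
  fixes p q :: "'a::regular_rickart_star_ring"
  assumes p: "projection p" and q: "projection q"
    and inv: "right_invariant x p" "right_invariant x q"
  shows "right_invariant x (proj_meet p q)"
proof -
  let ?m = "proj_meet p q"
  note m = proj_meet_absorb[OF p q]
  have "p * (x * p) * ?m = x * p * ?m" "q * (x * q) * ?m = x * q * ?m"
    using inv by (simp_all add: right_invariant_def)
  then have "p * (x * ?m) = x * ?m" "q * (x * ?m) = x * ?m"
    by (simp_all add: mult.assoc m)
  then show ?thesis unfolding right_invariant_def by (rule proj_meet_greatest[OF p q])
qed

text \<open>For self-adjoint \<open>c\<close> the adjoint of \<open>q * c * q = c * q\<close> is
  \<open>q * c * q = q * c\<close>. Commutation thus becomes an instance of invariance.\<close>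

lemma right_invariant_self_adjoint_iff:
  assumes "projection q" "star c = c"
  shows "right_invariant c q \<longleftrightarrow> q * c = c * q"
proof
  assume "right_invariant c q"
  then have *: "q * (c * q) = c * q" by (simp add: right_invariant_def)
  have "q * c = star (c * q)" by (simp add: star_mult assms projection_star)
  also have "\<dots> = star (q * (c * q))" by (simp only: *)
  also have "\<dots> = q * (c * q)" by (simp add: star_mult assms projection_star mult.assoc)
  finally show "q * c = c * q" by (simp only: *)
next
  assume "q * c = c * q"
  then show "right_invariant c q"
    by (simp add: right_invariant_def projection_mult_self[OF assms(1)] flip: mult.assoc)
      (simp add: mult.assoc projection_mult_self[OF assms(1)])
qed

section \<open>The star order below a fixed element\<close>

text \<open>Commutation with \<open>star b * b\<close> is encoded as invariance so that the closure
  lemmas for joins and meets apply directly.\<close>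

definition star_proj :: "'a::rickart_star_ring \<Rightarrow> 'a \<Rightarrow> bool"
  where "star_proj b q \<longleftrightarrow> projection q \<and> rp b * q = q \<and> right_invariant (star b * b) q"

lemma star_proj_imp_projection: "star_proj b q \<Longrightarrow> projection q"
  by (simp add: star_proj_def)

lemma star_proj_zero: "star_proj b 0"
  by (simp add: star_proj_def projection_zero right_invariant_def)

lemma star_proj_join:
  fixes b :: "'a::regular_rickart_star_ring"
  shows "star_proj b p \<Longrightarrow> star_proj b q \<Longrightarrow> star_proj b (proj_join p q)"
  by (simp add: star_proj_def projection_join proj_join_least right_invariant_join)

lemma star_proj_meet:
  fixes b :: "'a::regular_rickart_star_ring"
  assumes "star_proj b p" "star_proj b q"
  shows "star_proj b (proj_meet p q)"
proof -
  have p: "projection p" and q: "projection q" using assms by (auto simp: star_proj_def)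
  have "rp b * (p * proj_meet p q) = p * proj_meet p q"
    using assms by (simp add: star_proj_def flip: mult.assoc)
  then have "rp b * proj_meet p q = proj_meet p q" by (simp add: proj_meet_absorb[OF p q])
  then show ?thesis
    using assms by (simp add: star_proj_def projection_meet right_invariant_meet)
qed

text \<open>Left multiplication by \<open>b\<close> is injective on the right ideal of
  \<open>rp b\<close>, because \<open>b\<close> and \<open>rp b\<close> have the same right
  annihilator.\<close>

lemma star_proj_cancel:
  assumes "rp b * x = x" "rp b * y = y"
  shows "b * x = b * y \<longleftrightarrow> x = y"
  using assms by (subst mult_left_eq_iff) simp

lemma star_proj_mult: "star_proj b q \<Longrightarrow> rp b * (q * x) = q * x"
  by (simp add: star_proj_def flip: mult.assoc)

lemma rp_mult_star_proj:
  assumes "star_proj b q"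
  shows "rp (b * q) = q"
proof (rule rp_eqI)
  show "projection q" using assms by (simp add: star_proj_def)
  show "b * q * x = 0 \<longleftrightarrow> q * x = 0" for x
    using rp_spec(2)[of b "q * x"] star_proj_mult[OF assms] by (simp add: mult.assoc)
qed

lemma lp_mult_star_proj:
  fixes b :: "'a::regular_rickart_star_ring"
  assumes "star_proj b q"
  shows "lp (b * q) * b = b * q"
proof -
  let ?p = "lp (b * q)"
  have q: "projection q" using assms by (simp add: star_proj_def)
  obtain y where y: "?p = b * q * y" by (rule lp_factor)
  \<comment> \<open>Self-adjointness rewrites \<open>?p\<close> so that it ends in
    \<open>q * star b\<close>. Then \<open>?p * b\<close> contains \<open>q * (star b * b)\<close>,
    to which commutation applies.\<close>
  have "?p = star ?p" by (simp add: projection_star[OF lp_spec(1)])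
  also have "\<dots> = star y * (q * star b)"
    by (subst y) (simp add: star_mult projection_star[OF q])
  finally have p: "?p = star y * (q * star b)" .
  have comm: "q * (star b * b) = star b * b * q"
    using assms right_invariant_self_adjoint_iff[OF q, of "star b * b"]
    by (simp add: star_proj_def star_mult star_star)
  have "?p * b = star y * (q * (star b * b))" by (simp add: p mult.assoc)
  also have "\<dots> = star y * (q * (star b * b)) * q"
    by (simp add: comm mult.assoc projection_mult_self[OF q])
  also have "\<dots> = ?p * (b * q)" by (simp add: p mult.assoc)
  also have "\<dots> = b * q" by (rule lp_mult_self)
  finally show ?thesis .
qed

definition le_star :: "'a::rickart_star_ring \<Rightarrow> 'a \<Rightarrow> bool"
  where "le_star a b \<longleftrightarrow> lp a * b = a \<and> a = b * rp a"

text \<open>After cancelling \<open>b\<close>, the condition on \<open>lp\<close> reads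
  \<open>p * q = p\<close> and the one on \<open>rp\<close> reads \<open>p = q * p\<close>. For
  projections these are equivalent.\<close>

lemma le_star_mult_iff:
  fixes b :: "'a::regular_rickart_star_ring"
  assumes p: "star_proj b p" and q: "star_proj b q"
  shows "le_star (b * p) (b * q) \<longleftrightarrow> q * p = p"
proof -
  have pq: "q * p = p \<longleftrightarrow> p * q = p"
    using p q projection_absorb_iff by (auto simp: star_proj_def)
  have cancel: "b * (r * x) = b * (s * y) \<longleftrightarrow> r * x = s * y"
    if "star_proj b r" "star_proj b s" for r s x y
    using that by (intro star_proj_cancel star_proj_mult)
  have "lp (b * p) * (b * q) = b * (p * q)"
    by (simp add: lp_mult_star_proj[OF p] flip: mult.assoc)
  moreover have "b * (p * q) = b * p \<longleftrightarrow> p * q = p"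
    using cancel[OF p p, of q 1] by simp
  moreover have "b * p = b * q * rp (b * p) \<longleftrightarrow> p = q * p"
    using cancel[OF p q, of 1 p] by (simp add: rp_mult_star_proj[OF p] mult.assoc)
  ultimately show ?thesis using pq unfolding le_star_def by metis
qed

lemma le_star_iff:
  fixes b :: "'a::regular_rickart_star_ring"
  shows "le_star a b \<longleftrightarrow> (\<exists>q. star_proj b q \<and> a = b * q)"
proof
  assume a: "le_star a b"
  let ?q = "rp a"
  have q: "projection ?q" by (rule rp_spec)
  \<comment> \<open>This leads to \<open>rp a\<close> being below \<open>rp b\<close>: whatever
    \<open>b\<close> annihilates, \<open>a = lp a * b\<close> annihilates as well.\<close>
  have "a * (1 - rp b) = lp a * (b * (1 - rp b))"
    using a by (simp add: le_star_def flip: mult.assoc)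
  also have "\<dots> = 0" by (simp add: right_diff_distrib mult_rp_self)
  finally have "?q * (1 - rp b) = 0" by (subst (asm) rp_spec(2))
  then have "?q * rp b = ?q" by (simp add: right_diff_distrib)
  then have f: "rp b * ?q = ?q" using projection_absorb_iff[OF rp_spec(1) q] by blast
  \<comment> \<open>Both sides equal \<open>star b * a\<close>, and the right one is visibly
    self-adjoint. Hence the product of the self-adjoint \<open>star b * b\<close> and
    \<open>?q\<close> is self-adjoint, so the two commute.\<close>
  have *: "star b * b * ?q = star b * lp a * b"
    using a by (simp add: le_star_def mult.assoc)
  then have "star (star b * b * ?q) = star b * b * ?q"
    by (simp add: star_mult star_star projection_star[OF lp_spec(1)] mult.assoc)
  then have "?q * (star b * b) = star b * b * ?q"
    by (simp add: star_mult star_star projection_star[OF q] mult.assoc)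
  then have "star_proj b ?q"
    using q f right_invariant_self_adjoint_iff[OF q, of "star b * b"]
    by (simp add: star_proj_def star_mult star_star)
  then show "\<exists>q. star_proj b q \<and> a = b * q" using a by (auto simp: le_star_def)
next
  assume "\<exists>q. star_proj b q \<and> a = b * q"
  then show "le_star a b"
    by (auto simp: le_star_def lp_mult_star_proj rp_mult_star_proj)
qed

section \<open>Segments parametrized by projections\<close>

text \<open>In this locale \<open>P\<close> describes the projections \<open>rp a\<close> of the elements \<open>a\<close> of the segment.\<close>

locale projection_segment =
  fixes r :: "'a::regular_rickart_star_ring \<Rightarrow> 'a \<Rightarrow> bool" and b :: 'a and P :: "'a \<Rightarrow> bool"
  assumes below_iff: "r a b \<longleftrightarrow> (\<exists>q. P q \<and> a = b * q)"
    and le_iff: "P p \<Longrightarrow> P q \<Longrightarrow> r (b * p) (b * q) \<longleftrightarrow> q * p = p"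
    and star_proj: "P q \<Longrightarrow> star_proj b q"
    and join_closed: "P p \<Longrightarrow> P q \<Longrightarrow> P (proj_join p q)"
    and meet_closed: "P p \<Longrightarrow> P q \<Longrightarrow> P (proj_meet p q)"
begin

abbreviation "L \<equiv> initial_segment r b"

lemma proj: "P q \<Longrightarrow> projection q"
  using star_proj by (auto simp: star_proj_def)

lemma mem_iff: "x \<in> carrier L \<longleftrightarrow> (\<exists>q. P q \<and> x = b * q)"
  by (simp add: initial_segment_def below_iff)

lemma mem: "P q \<Longrightarrow> b * q \<in> carrier L"
  by (auto simp: mem_iff)

lemma le_L: "P p \<Longrightarrow> P q \<Longrightarrow> b * p \<sqsubseteq>\<^bsub>L\<^esub> b * q \<longleftrightarrow> q * p = p"
  by (simp add: initial_segment_def le_iff)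

lemma antisym_proj: "P p \<Longrightarrow> P q \<Longrightarrow> q * p = p \<Longrightarrow> p * q = q \<Longrightarrow> p = q"
  using projection_absorb_iff[OF proj proj, of p q] by simp

lemma partial_order_segment: "partial_order L"
proof
  fix x y z
  show "x .=\<^bsub>L\<^esub> x" by (simp add: initial_segment_def)
  show "x .=\<^bsub>L\<^esub> y \<Longrightarrow> y .=\<^bsub>L\<^esub> x" by (simp add: initial_segment_def)
  show "x .=\<^bsub>L\<^esub> y \<Longrightarrow> y .=\<^bsub>L\<^esub> z \<Longrightarrow> x .=\<^bsub>L\<^esub> z" by (simp add: initial_segment_def)
  show "x \<in> carrier L \<Longrightarrow> x \<sqsubseteq>\<^bsub>L\<^esub> x"
    by (auto simp: mem_iff le_L projection_mult_self proj)
  show "x .=\<^bsub>L\<^esub> y" if xy: "x \<sqsubseteq>\<^bsub>L\<^esub> y" "y \<sqsubseteq>\<^bsub>L\<^esub> x" "x \<in> carrier L" "y \<in> carrier L"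
  proof -
    obtain p q where pq: "P p" "P q" "x = b * p" "y = b * q"
      using xy(3,4) unfolding mem_iff by blast
    then have "q * p = p" "p * q = q" using xy by (simp_all add: le_L)
    then have "p = q" by (rule antisym_proj[OF pq(1,2)])
    then show ?thesis using pq by (simp add: initial_segment_def)
  qed
  show "x \<sqsubseteq>\<^bsub>L\<^esub> z" if xyz: "x \<sqsubseteq>\<^bsub>L\<^esub> y" "y \<sqsubseteq>\<^bsub>L\<^esub> z"
    "x \<in> carrier L" "y \<in> carrier L" "z \<in> carrier L"
  proof -
    obtain p q s where pqs: "P p" "P q" "P s" "x = b * p" "y = b * q" "z = b * s"
      using xyz(3-5) unfolding mem_iff by blast
    then have *: "q * p = p" "s * q = q" using xyz by (simp_all add: le_L)
    then have "s * p = p" using mult.assoc[of s q p] by simp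
    then show ?thesis using pqs by (simp add: le_L)
  qed
  show "(.=\<^bsub>L\<^esub>) = (=)" by (simp add: initial_segment_def)
  show "x .=\<^bsub>L\<^esub> y \<Longrightarrow> z .=\<^bsub>L\<^esub> w \<Longrightarrow> x \<sqsubseteq>\<^bsub>L\<^esub> z \<longleftrightarrow> y \<sqsubseteq>\<^bsub>L\<^esub> w" for w
    by (simp add: initial_segment_def)
qed

lemma least_join:
  assumes "P p" "P q"
  shows "least L (b * proj_join p q) (Upper L {b * p, b * q})"
  unfolding least_def
proof (intro conjI ballI)
  note j = join_closed[OF assms]
  show "b * proj_join p q \<in> Upper L {b * p, b * q}"
    using assms j mem
    by (auto simp: Upper_def le_L projection_join proj_join_absorb_right proj)
  show "Upper L {b * p, b * q} \<subseteq> carrier L" by (rule Upper_closed)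
  fix x assume x: "x \<in> Upper L {b * p, b * q}"
  then have "x \<in> carrier L" by (rule subsetD[OF Upper_closed])
  then obtain s where s: "P s" "x = b * s" by (auto simp: mem_iff)
  then have "b * p \<sqsubseteq>\<^bsub>L\<^esub> b * s" "b * q \<sqsubseteq>\<^bsub>L\<^esub> b * s" using x assms mem by (auto simp: Upper_def)
  then show "b * proj_join p q \<sqsubseteq>\<^bsub>L\<^esub> x" using assms s j by (simp add: le_L proj_join_least)
qed

lemma greatest_meet:
  assumes "P p" "P q"
  shows "greatest L (b * proj_meet p q) (Lower L {b * p, b * q})"
  unfolding greatest_def
proof (intro conjI ballI)
  note j = meet_closed[OF assms]
  show "b * proj_meet p q \<in> Lower L {b * p, b * q}"
    using assms j mem by (auto simp: Lower_def le_L proj_meet_absorb proj)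
  show "Lower L {b * p, b * q} \<subseteq> carrier L" by (rule Lower_closed)
  fix x assume x: "x \<in> Lower L {b * p, b * q}"
  then have "x \<in> carrier L" by (rule subsetD[OF Lower_closed])
  then obtain s where s: "P s" "x = b * s" by (auto simp: mem_iff)
  then have "b * s \<sqsubseteq>\<^bsub>L\<^esub> b * p" "b * s \<sqsubseteq>\<^bsub>L\<^esub> b * q" using x assms mem by (auto simp: Lower_def)
  then show "x \<sqsubseteq>\<^bsub>L\<^esub> b * proj_meet p q"
    using assms s j by (simp add: le_L proj_meet_greatest proj)
qed

lemma lattice_segment: "lattice L"
proof -
  interpret partial_order L by (rule partial_order_segment)
  show ?thesis
  proof
    fix x y assume "x \<in> carrier L" "y \<in> carrier L"
    then obtain p q where pq: "P p" "P q" "x = b * p" "y = b * q"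
      unfolding mem_iff by blast
    show "\<exists>s. least L s (Upper L {x, y})"
      unfolding pq(3,4) by (rule exI, rule least_join[OF pq(1,2)])
    show "\<exists>s. greatest L s (Lower L {x, y})"
      unfolding pq(3,4) by (rule exI, rule greatest_meet[OF pq(1,2)])
  qed
qed

lemma join_eq:
  assumes "P p" "P q"
  shows "(b * p) \<squnion>\<^bsub>L\<^esub> (b * q) = b * proj_join p q"
proof -
  interpret lattice L by (rule lattice_segment)
  show ?thesis
    unfolding join_def
    by (rule least_unique[OF sup_of_two_least[OF mem mem, OF assms] least_join[OF assms]])
qed

lemma meet_eq:
  assumes "P p" "P q"
  shows "(b * p) \<sqinter>\<^bsub>L\<^esub> (b * q) = b * proj_meet p q"
proof -
  interpret lattice L by (rule lattice_segment)
  show ?thesis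
    unfolding meet_def
    by (rule greatest_unique[OF inf_of_two_greatest[OF mem mem, OF assms]
          greatest_meet[OF assms]])
qed

end

text \<open>Joins and meets are given by formulas in \<open>b\<close>, \<open>p\<close> and
  \<open>q\<close> that do not mention the predicate. Those of the larger segment therefore stay in
  the smaller one by the closure properties of \<open>P\<close>; \<open>P 0\<close> makes it
  nonempty.\<close>

lemma sublattice_projection_segment:
  assumes "projection_segment r b P" "projection_segment r' b P'"
    and "P 0" and sub: "\<And>q. P q \<Longrightarrow> P' q"
  shows "sublattice (carrier (initial_segment r b)) (initial_segment r' b)"
proof -
  interpret H: projection_segment r b P by fact
  interpret K: projection_segment r' b P' by fact
  have "carrier H.L \<noteq> {}" using H.mem[OF \<open>P 0\<close>] by blast
  moreover have "carrier H.L \<subseteq> carrier K.L"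
    using sub unfolding subset_iff H.mem_iff K.mem_iff by blast
  moreover have "x \<squnion>\<^bsub>K.L\<^esub> y \<in> carrier H.L \<and> x \<sqinter>\<^bsub>K.L\<^esub> y \<in> carrier H.L"
    if xy: "x \<in> carrier H.L" "y \<in> carrier H.L" for x y
  proof -
    obtain p q where *: "P p" "P q" "x = b * p" "y = b * q"
      using xy unfolding H.mem_iff by blast
    then show ?thesis
      by (simp add: K.join_eq K.meet_eq sub H.mem H.join_closed H.meet_closed)
  qed
  ultimately show ?thesis by (simp add: sublattice_def)
qed

section \<open>The one-sided square conditions in terms of projections\<close>

definition left_proj :: "'a::rickart_star_ring \<Rightarrow> 'a \<Rightarrow> bool"
  where "left_proj b q \<longleftrightarrow> star_proj b q \<and> right_invariant b (1 - q)"

text \<open>Cancelling \<open>b\<close> on the left in \<open>b * (q * b * q) = b * (b * q)\<close>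
  leaves \<open>rp b\<close> in front of \<open>b * q\<close>, since \<open>b * q\<close> need not
  lie in the right ideal of \<open>rp b\<close>.\<close>

definition right_proj :: "'a::rickart_star_ring \<Rightarrow> 'a \<Rightarrow> bool"
  where "right_proj b q \<longleftrightarrow> star_proj b q \<and> right_invariant (rp b * b) q"

text \<open>Invariance for \<open>1 - q\<close> amounts to \<open>q * b * (1 - q) = 0\<close>.
  Multiplying by \<open>b\<close> on the left, which is injective here, turns this into the square
  condition.\<close>

lemma left_proj_iff:
  assumes q: "star_proj b q"
  shows "left_proj b q \<longleftrightarrow> (b * q) ^ 2 = b * q * b"
    and "left_proj b q \<longleftrightarrow> q * b * q = q * b"
proof -
  have "right_invariant b (1 - q) \<longleftrightarrow> q * b * q = q * b"
    by (auto simp: right_invariant_def algebra_simps)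
  then show 1: "left_proj b q \<longleftrightarrow> q * b * q = q * b" using q by (simp add: left_proj_def)
  note f = star_proj_mult[OF q]
  have "(b * q) ^ 2 = b * q * b \<longleftrightarrow> b * (q * (b * q)) = b * (q * b)"
    by (simp add: power2_eq_square mult.assoc)
  then show "left_proj b q \<longleftrightarrow> (b * q) ^ 2 = b * q * b"
    by (simp add: star_proj_cancel f 1 mult.assoc)
qed

lemma right_proj_iff:
  assumes q: "star_proj b q"
  shows "right_proj b q \<longleftrightarrow> (b * q) ^ 2 = b * (b * q)"
    and "right_proj b q \<longleftrightarrow> q * b * q = rp b * b * q"
proof -
  have f: "rp b * (q * x) = q * x" "q * (rp b * x) = q * x" for x
    using q projection_absorb_iff[OF rp_spec(1), of q b]
    by (simp_all add: star_proj_def flip: mult.assoc)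
  show 1: "right_proj b q \<longleftrightarrow> q * b * q = rp b * b * q"
    using q by (simp add: right_proj_def right_invariant_def mult.assoc f)
  have "(b * q) ^ 2 = b * (b * q) \<longleftrightarrow> b * (q * (b * q)) = b * (b * q)"
    by (simp add: power2_eq_square mult.assoc)
  then show "right_proj b q \<longleftrightarrow> (b * q) ^ 2 = b * (b * q)"
    by (subst (asm) mult_left_eq_iff) (simp add: f 1 mult.assoc)
qed

text \<open>The square condition relative to \<open>b\<close> passes to every \<open>b * q\<close>
  above \<open>b * p\<close>. Hence comparing two elements of the segment reduces to the star
  order.\<close>

lemma left_proj_square_mult:
  assumes p: "left_proj b p" and pq: "p * q = p"
  shows "(b * p) ^ 2 = b * p * (b * q)"
proof -
  have *: "p * b * p = p * b" using p left_proj_iff(2) by (auto simp: left_proj_def)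
  have "(b * p) ^ 2 = b * (p * b * p) * q" by (simp add: power2_eq_square mult.assoc pq)
  also have "\<dots> = b * p * (b * q)" unfolding * by (simp add: mult.assoc)
  finally show ?thesis .
qed

text \<open>Right-hand counterpart; the extra factor \<open>rp b\<close> is absorbed by
  \<open>q\<close>.\<close>

lemma right_proj_square_mult:
  assumes p: "right_proj b p" and qf: "q * rp b = q" and qp: "q * p = p"
  shows "(b * p) ^ 2 = b * q * (b * p)"
proof -
  have *: "p * b * p = rp b * b * p" using p right_proj_iff(2) by (auto simp: right_proj_def)
  have "(b * p) ^ 2 = b * (q * p) * (b * p)" by (simp add: qp power2_eq_square mult.assoc)
  also have "\<dots> = b * q * (p * b * p)" by (simp only: mult.assoc)
  also have "\<dots> = b * (q * rp b) * (b * p)" unfolding * by (simp only: mult.assoc)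
  finally show ?thesis by (simp only: qf)
qed

text \<open>The complement of a join is the meet of the complements, so a join of projections calls
  for invariance of a meet.\<close>

lemma left_proj_join:
  fixes b :: "'a::regular_rickart_star_ring"
  assumes "left_proj b p" "left_proj b q"
  shows "left_proj b (proj_join p q)"
proof -
  have "projection (1 - p)" "projection (1 - q)"
    using assms by (auto simp: left_proj_def star_proj_def intro: projection_compl)
  then have "right_invariant b (proj_meet (1 - p) (1 - q))"
    using assms by (simp add: left_proj_def right_invariant_meet)
  then show ?thesis using assms by (simp add: left_proj_def star_proj_join proj_meet_def)
qed

lemma left_proj_meet:
  fixes b :: "'a::regular_rickart_star_ring"
  assumes "left_proj b p" "left_proj b q"
  shows "left_proj b (proj_meet p q)"
proof -
  have "projection (1 - p)"
    using assms by (auto simp: left_proj_def star_proj_def intro: projection_compl)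
  then have "right_invariant b (proj_join (1 - p) (1 - q))"
    using assms by (simp add: left_proj_def right_invariant_join)
  then have "right_invariant b (1 - proj_meet p q)" by (simp add: proj_meet_def)
  then show ?thesis using assms by (simp add: left_proj_def star_proj_meet)
qed

lemma right_proj_join:
  fixes b :: "'a::regular_rickart_star_ring"
  shows "right_proj b p \<Longrightarrow> right_proj b q \<Longrightarrow> right_proj b (proj_join p q)"
  using right_invariant_join[of p "rp b * b" q]
  by (auto simp: right_proj_def star_proj_join dest: star_proj_imp_projection)

lemma right_proj_meet:
  fixes b :: "'a::regular_rickart_star_ring"
  shows "right_proj b p \<Longrightarrow> right_proj b q \<Longrightarrow> right_proj b (proj_meet p q)"
  using right_invariant_meet[of p q "rp b * b"]
  by (auto simp: right_proj_def star_proj_meet dest: star_proj_imp_projection)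

lemma le_star_lsq_iff: "le_star_lsq a b \<longleftrightarrow> le_star a b \<and> a ^ 2 = a * b"
  by (simp only: le_star_lsq_def le_star_def)

lemma projection_segment_lsq:
  fixes b :: "'a::regular_rickart_star_ring"
  shows "projection_segment le_star_lsq b (left_proj b)"
proof
  have "left_proj b q \<longleftrightarrow> star_proj b q \<and> (b * q) ^ 2 = b * q * b" for q
    using left_proj_iff(1)[of b q] unfolding left_proj_def by blast
  then show "le_star_lsq a b \<longleftrightarrow> (\<exists>q. left_proj b q \<and> a = b * q)" for a
    unfolding le_star_lsq_iff le_star_iff by blast
  show "le_star_lsq (b * p) (b * q) \<longleftrightarrow> q * p = p"
    if p: "left_proj b p" and q: "left_proj b q" for p q
  proof -
    have sp: "star_proj b p" and sq: "star_proj b q" using p q by (simp_all add: left_proj_def)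
    have "(b * p) ^ 2 = b * p * (b * q)" if "q * p = p"
      using left_proj_square_mult[OF p] that
        projection_absorb_iff[OF sq[THEN star_proj_imp_projection] sp[THEN star_proj_imp_projection]]
      by blast
    then show ?thesis unfolding le_star_lsq_iff le_star_mult_iff[OF sp sq] by blast
  qed
  show "star_proj b q" if "left_proj b q" for q using that by (simp add: left_proj_def)
  show "left_proj b (proj_join p q)" if "left_proj b p" "left_proj b q" for p q
    using that by (rule left_proj_join)
  show "left_proj b (proj_meet p q)" if "left_proj b p" "left_proj b q" for p q
    using that by (rule left_proj_meet)
qed

lemma le_star_rsq_iff: "le_star_rsq a b \<longleftrightarrow> le_star a b \<and> a ^ 2 = b * a"
  by (simp only: le_star_rsq_def le_star_def)

lemma projection_segment_rsq:
  fixes b :: "'a::regular_rickart_star_ring"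
  shows "projection_segment le_star_rsq b (right_proj b)"
proof
  have "right_proj b q \<longleftrightarrow> star_proj b q \<and> (b * q) ^ 2 = b * (b * q)" for q
    using right_proj_iff(1)[of b q] unfolding right_proj_def by blast
  then show "le_star_rsq a b \<longleftrightarrow> (\<exists>q. right_proj b q \<and> a = b * q)" for a
    unfolding le_star_rsq_iff le_star_iff by blast
  show "le_star_rsq (b * p) (b * q) \<longleftrightarrow> q * p = p"
    if p: "right_proj b p" and q: "right_proj b q" for p q
  proof -
    have sp: "star_proj b p" and sq: "star_proj b q" using p q by (simp_all add: right_proj_def)
    have "q * rp b = q"
      using sq projection_absorb_iff[OF rp_spec(1), of q b] by (simp add: star_proj_def)
    then have "(b * p) ^ 2 = b * q * (b * p)" if "q * p = p"
      using right_proj_square_mult[OF p] that by blast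
    then show ?thesis unfolding le_star_rsq_iff le_star_mult_iff[OF sp sq] by blast
  qed
  show "star_proj b q" if "right_proj b q" for q using that by (simp add: right_proj_def)
  show "right_proj b (proj_join p q)" if "right_proj b p" "right_proj b q" for p q
    using that by (rule right_proj_join)
  show "right_proj b (proj_meet p q)" if "right_proj b p" "right_proj b q" for p q
    using that by (rule right_proj_meet)
qed

lemma le_star_sq_iff: "le_star_sq a b \<longleftrightarrow> le_star_lsq a b \<and> le_star_rsq a b"
  unfolding le_star_sq_def le_star_lsq_def le_star_rsq_def by argo

lemma projection_segment_sq:
  fixes b :: "'a::regular_rickart_star_ring"
  shows "projection_segment le_star_sq b (\<lambda>q. left_proj b q \<and> right_proj b q)"
proof -
  interpret l: projection_segment le_star_lsq b "left_proj b" by (rule projection_segment_lsq)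
  interpret r: projection_segment le_star_rsq b "right_proj b" by (rule projection_segment_rsq)
  show ?thesis
  proof
    show "le_star_sq a b \<longleftrightarrow> (\<exists>q. (left_proj b q \<and> right_proj b q) \<and> a = b * q)" for a
    proof
      assume "le_star_sq a b"
      then obtain p q where *: "left_proj b p" "a = b * p" "right_proj b q" "a = b * q"
        by (auto simp: le_star_sq_iff l.below_iff r.below_iff)
      \<comment> \<open>Both parameters are recovered from the same element as
        \<open>rp a\<close>.\<close>
      then have "p = q"
        using rp_mult_star_proj[OF l.star_proj, of p] rp_mult_star_proj[OF r.star_proj, of q]
        by simp
      then show "\<exists>q. (left_proj b q \<and> right_proj b q) \<and> a = b * q" using * by blast
    qed (auto simp: le_star_sq_iff l.below_iff r.below_iff)
  qed (simp_all add: le_star_sq_iff l.le_iff r.le_iff l.star_proj l.join_closed r.join_closed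
      l.meet_closed r.meet_closed)
qed

theorem corollary40:
  fixes b :: "'a::regular_rickart_star_ring"
  shows "lattice (initial_segment le_star_lsq b) \<and>
    lattice (initial_segment le_star_rsq b) \<and>
    lattice (initial_segment le_star_sq b) \<and>
    sublattice (carrier (initial_segment le_star_sq b)) (initial_segment le_star_lsq b) \<and>
    sublattice (carrier (initial_segment le_star_sq b)) (initial_segment le_star_rsq b)"
proof (intro conjI)
  note seg = projection_segment_lsq[of b] projection_segment_rsq[of b] projection_segment_sq[of b]
  show "lattice (initial_segment le_star_lsq b)" "lattice (initial_segment le_star_rsq b)"
    "lattice (initial_segment le_star_sq b)"
    by (rule seg[THEN projection_segment.lattice_segment])+
  \<comment> \<open>The projection \<open>0\<close> corresponds to the element
    \<open>b * 0 = 0\<close>, which witnesses that the two-sided segment is nonempty.\<close>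
  have zero: "left_proj b 0 \<and> right_proj b 0"
    by (simp add: left_proj_def right_proj_def star_proj_zero right_invariant_def)
  show "sublattice (carrier (initial_segment le_star_sq b)) (initial_segment le_star_lsq b)"
    by (rule sublattice_projection_segment[OF seg(3,1) zero]) blast
  show "sublattice (carrier (initial_segment le_star_sq b)) (initial_segment le_star_rsq b)"
    by (rule sublattice_projection_segment[OF seg(3,2) zero]) blast
qed

end
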